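(* Let $\kappa>0$ be an ordinal and let $\mathbb S=\langle X_\alpha; r_\alpha^\beta;\kappa\rangle$ be a continuous inverse sequence of compact spaces such that $X_0$ is Valdivia compact and, for each $\alpha$ with $\alpha+1<\kappa$, the bonding map $r_\alpha^{\alpha+1}\colon X_{\alpha+1}\to X_\alpha$ is a simple retraction. Then $X=\varprojlim\mathbb S$ is Valdivia compact.
   Context: All spaces are Hausdorff and "map" means continuous map. For a set $T$, $[0,1]^T$ is the Tikhonov cube and $\Sigma(T)=\{x\in[0,1]^T: \{\alpha\in T: x(\alpha)\neq 0\}\text{ is countable}\}$. A compact space $X$ is Valdivia compact if for some set $T$ there is an embedding $h\colon X\to[0,1]^T$ with $h[X]=\operatorname{cl}(\Sigma(T)\cap h[X])$, the closure being taken in $[0,1]^T$. A retraction is a map $r\colon X\to Y$ having a right inverse, i.e. a map $g\colon Y\to X$ with $r g=\mathrm{id}_Y$. A retraction $r\colon X\to Y$ is simple if (1) for every nonempty open $u\subseteq X$ the image $r[u]$ contains a nonempty $G_\delta$ subset of $Y$; and (2) there exists a map $g\colon X\to[0,1]^{\aleph_0}$ such that the diagonal map $x\mapsto\langle r(x),g(x)\rangle$ from $X$ to $Y\times[0,1]^{\aleph_0}$ is one-to-one. An inverse sequence $\langle X_\alpha;r_\alpha^\beta;\kappa\rangle$ is an inverse system of compact spaces with surjective bonding maps $r_\alpha^\beta\colon X_\beta\to X_\alpha$ ($\alpha\le\beta<\kappa$) indexed by an ordinal $\kappa$. It is continuous if, for every directed $T\subseteq\kappa$ and $\delta<\kappa$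 with $\delta=\sup T$, $X_\delta$ together with the maps $r^\delta_\alpha$ ($\alpha\in T$) is the limit of the system restricted to $T$ (equivalently, this holds with $T=\delta$ for each limit ordinal $\delta<\kappa$). *)

theory Defs
  imports "HOL-Analysis.Analysis"
begin

section \<open>Valdivia compact spaces\<close>

definition tikhonov_cube :: "'t set \<Rightarrow> ('t \<Rightarrow> real) topology" where
  "tikhonov_cube T = product_topology (\<lambda>_. top_of_set {0..1}) T"

definition Sigma_product :: "'t set \<Rightarrow> ('t \<Rightarrow> real) set" where
  "Sigma_product T = {x \<in> topspace (tikhonov_cube T). countable {\<alpha> \<in> T. x \<alpha> \<noteq> 0}}"

definition Valdivia_embedding :: "'a topology \<Rightarrow> 't set \<Rightarrow> ('a \<Rightarrow> 't \<Rightarrow> real) \<Rightarrow> bool" where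
  "Valdivia_embedding X T h \<longleftrightarrow>
     embedding_map X (tikhonov_cube T) h \<and>
     h ` topspace X = tikhonov_cube T closure_of (Sigma_product T \<inter> h ` topspace X)"

text \<open>
  A definition cannot quantify over the type of the index set \<open>T\<close>. Letting \<open>T\<close> range over the sets of
  functions \<open>'a \<Rightarrow> real\<close> is no restriction: by lemma \<open>Valdivia_compactI\<close> below, an embedding
  with an index set of any type yields one of this kind (index by the coordinate functions).
\<close>

definition Valdivia_compact :: "'a topology \<Rightarrow> bool" where
  "Valdivia_compact X \<longleftrightarrow> compact_space X \<and> Hausdorff_space X \<and>
     (\<exists>(T :: ('a \<Rightarrow> real) set) h. Valdivia_embedding X T h)"

lemma Valdivia_compactI:
  fixes X :: "'a topology" and T :: "'t set"
  assumes X: "compact_space X" "Hausdorff_space X" and h: "Valdivia_embedding X T h"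
  shows "Valdivia_compact X"
proof -
  define f where "f t = restrict (\<lambda>x. h x t) (topspace X)" for t
  define h' where "h' x = (\<lambda>g \<in> f ` T. g x)" for x
  let ?C = "tikhonov_cube T" and ?C' = "tikhonov_cube (f ` T)"
  let ?D = "{x \<in> topspace X. h x \<in> Sigma_product T}"
  have emb: "embedding_map X ?C h"
    and cl: "h ` topspace X = ?C closure_of (Sigma_product T \<inter> h ` topspace X)"
    using h by (auto simp: Valdivia_embedding_def)
  have hom: "homeomorphic_map X (subtopology ?C (h ` topspace X)) h"
    using emb by (simp add: embedding_map_def)
  have conth: "continuous_map X ?C h"
    using homeomorphic_imp_continuous_map[OF hom] by (simp add: continuous_map_in_subtopology)
  have ext: "h x \<in> extensional T" if "x \<in> topspace X" for x
    using continuous_map_image_subset_topspace[OF conth] that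
    by (auto simp: tikhonov_cube_def PiE_def)
  have injh: "inj_on h (topspace X)"
    using hom by (rule homeomorphic_imp_injective_map)
  have cont': "continuous_map X ?C' h'"
    unfolding tikhonov_cube_def continuous_map_componentwise
  proof (intro conjI ballI)
    fix g assume g: "g \<in> f ` T"
    then obtain t where t: "t \<in> T" "g = f t" by (rule imageE)
    have "continuous_map X (top_of_set {0..1}) (\<lambda>x. h x t)"
      using conth t(1) unfolding tikhonov_cube_def continuous_map_componentwise by (elim conjE bspec)
    then show "continuous_map X (top_of_set {0..1}) (\<lambda>x. h' x g)"
      by (rule continuous_map_eq) (use g t in \<open>auto simp: h'_def f_def\<close>)
  qed (auto simp: h'_def)
  have inj': "inj_on h' (topspace X)"
  proof (rule inj_onI)
    fix x y assume xy: "x \<in> topspace X" "y \<in> topspace X" "h' x = h' y"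
    have "h x t = h y t" if "t \<in> T" for t
      using fun_cong[OF xy(3), of "f t"] that xy(1,2) by (simp add: h'_def f_def)
    then have "h x = h y" using ext xy by (intro extensionalityI[of _ T]) auto
    then show "x = y" using injh xy by (auto dest: inj_onD)
  qed
  have haus: "Hausdorff_space ?C'"
    unfolding tikhonov_cube_def by (simp add: Hausdorff_space_product_topology Hausdorff_space_subtopology)
  have closed': "closed_map X ?C' h'"
    using X cont' haus by (simp add: continuous_imp_closed_map_gen Hausdorff_imp_kc_space)
  have emb': "embedding_map X ?C' h'"
    using cont' closed' inj' by (rule injective_closed_imp_embedding_map)
  have Sig: "Sigma_product T \<inter> h ` topspace X = h ` ?D" by blast
  have "h ` topspace X = subtopology ?C (h ` topspace X) closure_of (h ` ?D)"
  proof -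
    have "h ` topspace X \<inter> h ` ?D = h ` ?D" by blast
    moreover have "?C closure_of (h ` ?D) = h ` topspace X" using cl unfolding Sig by (rule sym)
    ultimately show ?thesis unfolding closure_of_subtopology by simp
  qed
  also have "\<dots> = h ` (X closure_of ?D)"
    by (rule homeomorphic_map_closure_of[OF hom]) auto
  finally have dense: "X closure_of ?D = topspace X"
    by (rule inj_on_image_eq_iff[OF injh closure_of_subset_topspace subset_refl, THEN iffD1, OF sym])
  have sub: "h' ` ?D \<subseteq> Sigma_product (f ` T) \<inter> h' ` topspace X"
  proof
    fix y assume "y \<in> h' ` ?D"
    then obtain x where x: "x \<in> topspace X" "h x \<in> Sigma_product T" "y = h' x" by blast
    have "{g \<in> f ` T. h' x g \<noteq> 0} \<subseteq> f ` {t \<in> T. h x t \<noteq> 0}"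
      using x(1) by (auto simp: h'_def f_def)
    moreover have "countable {t \<in> T. h x t \<noteq> 0}" using x(2) by (simp add: Sigma_product_def)
    ultimately have "countable {g \<in> f ` T. h' x g \<noteq> 0}"
      by (rule countable_subset[OF _ countable_image])
    moreover have "h' x \<in> topspace ?C'"
      using continuous_map_image_subset_topspace[OF cont'] x(1) by blast
    ultimately show "y \<in> Sigma_product (f ` T) \<inter> h' ` topspace X"
      using x by (auto simp: Sigma_product_def)
  qed
  have "h' ` topspace X = ?C' closure_of (Sigma_product (f ` T) \<inter> h' ` topspace X)"
  proof
    have "h' ` topspace X \<subseteq> ?C' closure_of (h' ` ?D)"
      using continuous_map_image_closure_subset[OF cont', of ?D] dense by simp
    also have "\<dots> \<subseteq> ?C' closure_of (Sigma_product (f ` T) \<inter> h' ` topspace X)"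
      by (rule closure_of_mono[OF sub])
    finally show "h' ` topspace X \<subseteq> \<dots>" .
    show "?C' closure_of (Sigma_product (f ` T) \<inter> h' ` topspace X) \<subseteq> h' ` topspace X"
      using closed' by (intro closure_of_minimal) (auto simp: closed_map_def)
  qed
  with emb' have "Valdivia_embedding X (f ` T) h'" by (simp add: Valdivia_embedding_def)
  then show ?thesis using X unfolding Valdivia_compact_def by blast
qed

section \<open>Simple retractions\<close>

definition retraction_onto :: "'a topology \<Rightarrow> 'b topology \<Rightarrow> ('a \<Rightarrow> 'b) \<Rightarrow> bool" where
  "retraction_onto X Y r \<longleftrightarrow> (\<exists>g. retraction_maps X Y r g)"

definition simple_retraction :: "'a topology \<Rightarrow> 'b topology \<Rightarrow> ('a \<Rightarrow> 'b) \<Rightarrow> bool" where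
  "simple_retraction X Y r \<longleftrightarrow>
     retraction_onto X Y r \<and>
     (\<forall>u. openin X u \<and> u \<noteq> {} \<longrightarrow> (\<exists>G. gdelta_in Y G \<and> G \<noteq> {} \<and> G \<subseteq> r ` u)) \<and>
     (\<exists>g. continuous_map X (tikhonov_cube (UNIV :: nat set)) g \<and>
          inj_on (\<lambda>x. (r x, g x)) (topspace X))"

section \<open>Inverse sequences\<close>

text \<open>
  Ordinals are represented by well-order relations: \<open>Field \<kappa>\<close> is the set of ordinals below \<open>\<kappa>\<close>,
  and \<open>(\<alpha>, \<beta>) \<in> \<kappa>\<close> means \<open>\<alpha> \<le> \<beta> < \<kappa>\<close>. Throughout, \<open>r \<alpha> \<beta>\<close> maps \<open>X \<beta>\<close> to \<open>X \<alpha>\<close>.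
\<close>

definition is_first :: "'i rel \<Rightarrow> 'i \<Rightarrow> bool" where
  "is_first \<kappa> \<zeta> \<longleftrightarrow> wo_rel.isMinim \<kappa> (Field \<kappa>) \<zeta>"

text \<open>\<open>is_next \<kappa> \<alpha> \<beta>\<close> says that \<open>\<beta> = \<alpha> + 1 < \<kappa>\<close>, and \<open>is_sup \<kappa> T \<delta>\<close> that \<open>\<delta> = sup T < \<kappa>\<close>.\<close>

definition is_next :: "'i rel \<Rightarrow> 'i \<Rightarrow> 'i \<Rightarrow> bool" where
  "is_next \<kappa> \<alpha> \<beta> \<longleftrightarrow> \<alpha> \<in> Field \<kappa> \<and> wo_rel.isMinim \<kappa> (AboveS \<kappa> {\<alpha>}) \<beta>"

definition is_sup :: "'i rel \<Rightarrow> 'i set \<Rightarrow> 'i \<Rightarrow> bool" where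
  "is_sup \<kappa> T \<delta> \<longleftrightarrow> wo_rel.isMinim \<kappa> (Above \<kappa> T) \<delta>"

definition directed_in :: "'i rel \<Rightarrow> 'i set \<Rightarrow> bool" where
  "directed_in \<kappa> T \<longleftrightarrow> T \<noteq> {} \<and> T \<subseteq> Field \<kappa> \<and>
     (\<forall>\<alpha>\<in>T. \<forall>\<beta>\<in>T. \<exists>\<gamma>\<in>T. (\<alpha>, \<gamma>) \<in> \<kappa> \<and> (\<beta>, \<gamma>) \<in> \<kappa>)"

definition inverse_sequence ::
  "'i rel \<Rightarrow> ('i \<Rightarrow> 'a topology) \<Rightarrow> ('i \<Rightarrow> 'i \<Rightarrow> 'a \<Rightarrow> 'a) \<Rightarrow> bool" where
  "inverse_sequence \<kappa> X r \<longleftrightarrow>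
     Well_order \<kappa> \<and>
     (\<forall>\<alpha>\<in>Field \<kappa>. compact_space (X \<alpha>) \<and> Hausdorff_space (X \<alpha>)) \<and>
     (\<forall>\<alpha> \<beta>. (\<alpha>, \<beta>) \<in> \<kappa> \<longrightarrow>
        continuous_map (X \<beta>) (X \<alpha>) (r \<alpha> \<beta>) \<and> r \<alpha> \<beta> ` topspace (X \<beta>) = topspace (X \<alpha>)) \<and>
     (\<forall>\<alpha>\<in>Field \<kappa>. \<forall>x\<in>topspace (X \<alpha>). r \<alpha> \<alpha> x = x) \<and>
     (\<forall>\<alpha> \<beta> \<gamma>. (\<alpha>, \<beta>) \<in> \<kappa> \<longrightarrow> (\<beta>, \<gamma>) \<in> \<kappa> \<longrightarrow>
        (\<forall>x\<in>topspace (X \<gamma>). r \<alpha> \<beta> (r \<beta> \<gamma> x) = r \<alpha> \<gamma> x))"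

text \<open>The limit of the system restricted to the index set \<open>T\<close>, as the space of threads.\<close>

definition inverse_limit ::
  "'i rel \<Rightarrow> ('i \<Rightarrow> 'a topology) \<Rightarrow> ('i \<Rightarrow> 'i \<Rightarrow> 'a \<Rightarrow> 'a) \<Rightarrow> 'i set \<Rightarrow> ('i \<Rightarrow> 'a) topology" where
  "inverse_limit \<kappa> X r T =
     subtopology (product_topology X T)
       {x. \<forall>\<alpha>\<in>T. \<forall>\<beta>\<in>T. (\<alpha>, \<beta>) \<in> \<kappa> \<longrightarrow> r \<alpha> \<beta> (x \<beta>) = x \<alpha>}"

text \<open>
  A space \<open>Z\<close> with compatible maps \<open>p\<^sub>\<alpha>\<close> (\<open>\<alpha> \<in> T\<close>) is the limit of the system restricted to
  \<open>T\<close> iff the canonical map from \<open>Z\<close> to the space of threads is a homeomorphism.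
\<close>

definition continuous_sequence ::
  "'i rel \<Rightarrow> ('i \<Rightarrow> 'a topology) \<Rightarrow> ('i \<Rightarrow> 'i \<Rightarrow> 'a \<Rightarrow> 'a) \<Rightarrow> bool" where
  "continuous_sequence \<kappa> X r \<longleftrightarrow>
     (\<forall>T \<delta>. directed_in \<kappa> T \<and> is_sup \<kappa> T \<delta> \<longrightarrow>
        homeomorphic_map (X \<delta>) (inverse_limit \<kappa> X r T) (\<lambda>x. \<lambda>\<alpha>\<in>T. r \<alpha> \<delta> x))"

end

theory Submission
  imports Defs
begin

text \<open>
  On a successor stage, a map \<open>g\<close> witnessing that the bonding map is simple is replaced by the positive
  and negative parts of the coordinates of \<open>g x - g (i (r x))\<close>, where \<open>i\<close> is a section of \<open>r\<close>. Together
  with \<open>r\<close> these still separate points, and they vanish on the range of \<open>i\<close>. The coordinates of all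
  successor stages and those of a Valdivia embedding of \<open>X\<^sub>0\<close> embed the limit into a cube. Let \<open>D\<^sub>\<alpha>\<close> be
  the set of points of \<open>X\<^sub>\<alpha>\<close> having countably many nonzero coordinates; it is dense by induction on
  \<open>\<alpha>\<close>. A dense set of this kind meets every nonempty \<open>G\<^sub>\<delta>\<close> set, which gives the successor step. In the
  limit step, a point of some earlier \<open>D\<^sub>\<alpha>\<close> is lifted along the sections, so that no further coordinate
  becomes nonzero.
\<close>

section \<open>Points of countable support\<close>

lemma dense_countable_support_meets_gdelta:
  fixes e :: "'j \<Rightarrow> 'a \<Rightarrow> real"
  assumes Y: "compact_space Y" "Hausdorff_space Y"
    and e: "\<And>j. j \<in> J \<Longrightarrow> continuous_map Y euclideanreal (e j)"
    and dense: "\<And>U. openin Y U \<Longrightarrow> U \<noteq> {} \<Longrightarrow> \<exists>y\<in>U. countable {j \<in> J. e j y \<noteq> 0}"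
    and G: "gdelta_in Y G" "G \<noteq> {}"
  shows "\<exists>y\<in>G. countable {j \<in> J. e j y \<noteq> 0}"
proof -
  obtain W where "(\<forall>n. openin Y (W n)) \<and> (\<forall>n. W (Suc n) \<subseteq> W n) \<and> \<Inter>(range W) = G"
    using G(1) unfolding gdelta_in_descending ..
  then have W: "\<And>n. openin Y (W n)" "\<Inter>(range W) = G" by blast+
  obtain p where p: "p \<in> G" using G(2) by blast
  have "neighbourhood_base_of (closedin Y) Y"
    using Y by (simp add: neighbourhood_base_of_closedin compact_Hausdorff_imp_regular_space)
  moreover have "p \<in> W n" for n using p W(2) by blast
  ultimately have "\<exists>U C. openin Y U \<and> closedin Y C \<and> p \<in> U \<and> U \<subseteq> C \<and> C \<subseteq> W n" for n
    using W(1) unfolding neighbourhood_base_of by (metis (no_types, lifting))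
  then obtain U C where U: "\<And>n. openin Y (U n)" "\<And>n. p \<in> U n" "\<And>n. U n \<subseteq> C n"
    and C: "\<And>n. closedin Y (C n)" "\<And>n. C n \<subseteq> W n"
    by metis
  have "openin Y (\<Inter>k\<in>{..n}. U k)" for n
    by (rule openin_Inter) (use U(1) in auto)
  moreover have "(\<Inter>k\<in>{..n}. U k) \<noteq> {}" for n using U(2) by blast
  ultimately have "\<exists>y\<in>(\<Inter>k\<in>{..n}. U k). countable {j \<in> J. e j y \<noteq> 0}" for n by (rule dense)
  then obtain d where d: "\<And>n. d n \<in> (\<Inter>k\<in>{..n}. U k)" "\<And>n. countable {j \<in> J. e j (d n) \<noteq> 0}"
    by metis
  have dY: "d n \<in> topspace Y" for n
    using d(1)[of n] U(1)[of n] by (auto dest: openin_subset)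
  have "(\<Inter>n. Y closure_of (d ` {n..})) \<noteq> {}"
  proof (rule compact_space_imp_nest[OF Y(1)])
    show "Y closure_of (d ` {n..}) \<noteq> {}" for n
      using closure_of_subset[of "d ` {n..}" Y] dY by fastforce
    show "decseq (\<lambda>n. Y closure_of (d ` {n..}))"
      unfolding decseq_def by (auto intro!: closure_of_mono)
  qed auto
  then obtain y where y: "\<And>n. y \<in> Y closure_of (d ` {n..})" by blast
  have "y \<in> C n" for n
  proof -
    have "d ` {n..} \<subseteq> C n" using d(1) U(3) by fastforce
    then show ?thesis using y[of n] closure_of_minimal[OF _ C(1)] by blast
  qed
  then have "y \<in> G" using C(2) W(2) by blast
  moreover have "{j \<in> J. e j y \<noteq> 0} \<subseteq> (\<Union>n. {j \<in> J. e j (d n) \<noteq> 0})"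
  proof (rule ccontr)
    assume "\<not> ?thesis"
    then obtain j where j: "j \<in> J" "e j y \<noteq> 0" "\<And>n. e j (d n) = 0" by blast
    have "e j y = 0"
      by (rule forall_in_closure_of_eq[OF y[of 0] _ e[OF j(1)], of "\<lambda>_. 0"]) (use j(3) in auto)
    with j(2) show False by simp
  qed
  then have "countable {j \<in> J. e j y \<noteq> 0}"
    by (rule countable_subset) (use d(2) in simp)
  ultimately show ?thesis by blast
qed

lemma simple_retraction_coordinates:
  assumes "simple_retraction X Y r"
  obtains c :: "nat \<Rightarrow> 'a \<Rightarrow> real"
  where "\<And>n. continuous_map X (top_of_set {0..1}) (c n)"
    and "\<And>x y. \<lbrakk>x \<in> topspace X; y \<in> topspace X; r x = r y; \<And>n. c n x = c n y\<rbrakk> \<Longrightarrow> x = y"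
    and "\<And>y. y \<in> topspace Y \<Longrightarrow> \<exists>x\<in>topspace X. r x = y \<and> (\<forall>n. c n x = 0)"
proof -
  obtain g i where g: "continuous_map X (tikhonov_cube (UNIV :: nat set)) g"
      "inj_on (\<lambda>x. (r x, g x)) (topspace X)"
    and i: "retraction_maps X Y r i"
    using assms unfolding simple_retraction_def retraction_onto_def by blast
  define q where "q x = i (r x)" for x
  have r: "continuous_map X Y r" and ic: "continuous_map Y X i" and ri: "\<And>y. y \<in> topspace Y \<Longrightarrow> r (i y) = y"
    using i by (auto simp: retraction_maps_def)
  have q: "continuous_map X X q"
    using continuous_map_compose[OF r ic] by (simp add: q_def[abs_def] comp_def)
  have gk01: "continuous_map X (top_of_set {0..1}) (\<lambda>x. g x k)" for k
    using g(1) unfolding tikhonov_cube_def continuous_map_componentwise by blast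
  then have gk: "continuous_map X euclideanreal (\<lambda>x. g x k)" for k
    by (rule continuous_map_into_fulltopology)
  have bd: "0 \<le> g x k \<and> g x k \<le> 1" if "x \<in> topspace X" for x k
    using continuous_map_image_subset_topspace[OF gk01[of k]] that by auto
  have qX: "q x \<in> topspace X" if "x \<in> topspace X" for x
    using continuous_map_image_subset_topspace[OF q] that by auto
  have gq: "continuous_map X euclideanreal (\<lambda>x. g (q x) k)" for k
    using continuous_map_compose[OF q gk[of k]] by (simp add: comp_def)
  define c where "c n x = max 0 ((if even n then 1 else -1) * (g x (n div 2) - g (q x) (n div 2)))" for n x
  show ?thesis
  proof
    show "continuous_map X (top_of_set {0..1}) (c n)" for n
    proof (rule continuous_map_into_subtopology)
      show "continuous_map X euclideanreal (c n)"
        unfolding c_def by (intro continuous_intros gk gq)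
      show "c n \<in> topspace X \<rightarrow> {0..1}"
        using bd[of _ "n div 2"] bd[OF qX, of _ "n div 2"] by (force simp: c_def)
    qed
    show "x = y" if xy: "x \<in> topspace X" "y \<in> topspace X" "r x = r y" "\<And>n. c n x = c n y" for x y
    proof -
      have "g x k = g y k" for k
        using xy(4)[of "2 * k"] xy(4)[of "2 * k + 1"] xy(3) by (auto simp: c_def q_def max_def split: if_splits)
      then show ?thesis using g(2) xy(1-3) by (auto dest!: inj_onD intro: ext)
    qed
    show "\<exists>x\<in>topspace X. r x = y \<and> (\<forall>n. c n x = 0)" if y: "y \<in> topspace Y" for y
      using continuous_map_image_subset_topspace[OF ic] ri y
      by (intro bexI[of _ "i y"]) (auto simp: c_def q_def)
  qed
qed

section \<open>Successors and limits\<close>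

lemma (in wo_rel) is_next_below:
  assumes "is_next r \<beta> \<gamma>" "(\<alpha>, \<gamma>) \<in> r" "\<alpha> \<noteq> \<gamma>"
  shows "(\<alpha>, \<beta>) \<in> r"
proof (rule ccontr)
  have F: "\<alpha> \<in> Field r" "\<beta> \<in> Field r" and min: "\<And>\<delta>. \<delta> \<in> AboveS {\<beta>} \<Longrightarrow> (\<gamma>, \<delta>) \<in> r"
    using assms(1,2) unfolding is_next_def isMinim_def by (auto simp: Field_def)
  assume "(\<alpha>, \<beta>) \<notin> r"
  then have "(\<beta>, \<alpha>) \<in> r" "\<alpha> \<noteq> \<beta>" using TOTALS REFL F by (auto simp: refl_on_def)
  then have "(\<gamma>, \<alpha>) \<in> r" using F by (intro min) (auto simp: AboveS_def)
  then show False using assms(2,3) antisymD[OF ANTISYM] by blast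
qed

locale coordinatized_sequence =
  fixes \<kappa> :: "'i rel" and X :: "'i \<Rightarrow> 'a topology" and r :: "'i \<Rightarrow> 'i \<Rightarrow> 'a \<Rightarrow> 'a"
    and \<zeta> :: 'i and T\<^sub>0 :: "'t set" and h :: "'a \<Rightarrow> 't \<Rightarrow> real" and c :: "'i \<Rightarrow> nat \<Rightarrow> 'a \<Rightarrow> real"
  assumes inv: "inverse_sequence \<kappa> X r"
    and cont: "continuous_sequence \<kappa> X r"
    and first: "is_first \<kappa> \<zeta>"
    and h: "Valdivia_embedding (X \<zeta>) T\<^sub>0 h"
    and c_cont: "is_next \<kappa> \<beta> \<gamma> \<Longrightarrow> continuous_map (X \<gamma>) (top_of_set {0..1}) (c \<gamma> n)"
    and c_inj: "\<lbrakk>is_next \<kappa> \<beta> \<gamma>; x \<in> topspace (X \<gamma>); y \<in> topspace (X \<gamma>); r \<beta> \<gamma> x = r \<beta> \<gamma> y;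
      \<And>n. c \<gamma> n x = c \<gamma> n y\<rbrakk> \<Longrightarrow> x = y"
    and c_zero: "\<lbrakk>is_next \<kappa> \<beta> \<gamma>; y \<in> topspace (X \<beta>)\<rbrakk> \<Longrightarrow>
      \<exists>x\<in>topspace (X \<gamma>). r \<beta> \<gamma> x = y \<and> (\<forall>n. c \<gamma> n x = 0)"
    and gdelta_image: "\<lbrakk>is_next \<kappa> \<beta> \<gamma>; openin (X \<gamma>) U; U \<noteq> {}\<rbrakk> \<Longrightarrow>
      \<exists>G. gdelta_in (X \<beta>) G \<and> G \<noteq> {} \<and> G \<subseteq> r \<beta> \<gamma> ` U"
begin

sublocale wo_rel \<kappa>
  using inv by (simp add: inverse_sequence_def wo_rel_def)

definition succs :: "'i set" where
  "succs = {\<gamma>. \<exists>\<beta>. is_next \<kappa> \<beta> \<gamma>}"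

definition coord :: "('i \<Rightarrow> 'a) \<Rightarrow> 't + 'i \<times> nat \<Rightarrow> real" where
  "coord z = case_sum (h (z \<zeta>)) (\<lambda>(\<gamma>, n). c \<gamma> n (z \<gamma>))"

definition coords :: "'i set \<Rightarrow> ('t + 'i \<times> nat) set" where
  "coords T = T\<^sub>0 <+> (T \<inter> succs) \<times> UNIV"

definition support :: "'i set \<Rightarrow> ('i \<Rightarrow> 'a) \<Rightarrow> ('t + 'i \<times> nat) set" where
  "support T z = {j \<in> coords T. coord z j \<noteq> 0}"

definition thread :: "'i \<Rightarrow> 'a \<Rightarrow> 'i \<Rightarrow> 'a" where
  "thread \<delta> x = (\<lambda>\<alpha>. r \<alpha> \<delta> x)"

lemma coord_simps [simp]:
  "coord z (Inl t) = h (z \<zeta>) t" "coord z (Inr (\<gamma>, n)) = c \<gamma> n (z \<gamma>)"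
  by (simp_all add: coord_def)

lemma refl: "\<alpha> \<in> Field \<kappa> \<Longrightarrow> (\<alpha>, \<alpha>) \<in> \<kappa>"
  using REFL by (simp add: refl_on_def)

lemma trans: "(\<alpha>, \<beta>) \<in> \<kappa> \<Longrightarrow> (\<beta>, \<gamma>) \<in> \<kappa> \<Longrightarrow> (\<alpha>, \<gamma>) \<in> \<kappa>"
  using TRANS by (rule transD)

lemma antisym: "(\<alpha>, \<beta>) \<in> \<kappa> \<Longrightarrow> (\<beta>, \<alpha>) \<in> \<kappa> \<Longrightarrow> \<alpha> = \<beta>"
  using ANTISYM by (rule antisymD)

lemma total: "\<alpha> \<in> Field \<kappa> \<Longrightarrow> \<beta> \<in> Field \<kappa> \<Longrightarrow> (\<alpha>, \<beta>) \<in> \<kappa> \<or> (\<beta>, \<alpha>) \<in> \<kappa>"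
  using TOTALS by blast

lemma Field: "(\<alpha>, \<beta>) \<in> \<kappa> \<Longrightarrow> \<alpha> \<in> Field \<kappa>" "(\<alpha>, \<beta>) \<in> \<kappa> \<Longrightarrow> \<beta> \<in> Field \<kappa>"
  by (auto simp: Field_def)

lemma compact: "\<alpha> \<in> Field \<kappa> \<Longrightarrow> compact_space (X \<alpha>)"
  and Hausdorff: "\<alpha> \<in> Field \<kappa> \<Longrightarrow> Hausdorff_space (X \<alpha>)"
  and r_cont: "(\<alpha>, \<beta>) \<in> \<kappa> \<Longrightarrow> continuous_map (X \<beta>) (X \<alpha>) (r \<alpha> \<beta>)"
  and r_id: "\<alpha> \<in> Field \<kappa> \<Longrightarrow> x \<in> topspace (X \<alpha>) \<Longrightarrow> r \<alpha> \<alpha> x = x"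
  and r_comp: "(\<alpha>, \<beta>) \<in> \<kappa> \<Longrightarrow> (\<beta>, \<gamma>) \<in> \<kappa> \<Longrightarrow> x \<in> topspace (X \<gamma>) \<Longrightarrow> r \<alpha> \<beta> (r \<beta> \<gamma> x) = r \<alpha> \<gamma> x"
  using inv by (simp_all add: inverse_sequence_def)

lemma r_in: "(\<alpha>, \<beta>) \<in> \<kappa> \<Longrightarrow> x \<in> topspace (X \<beta>) \<Longrightarrow> r \<alpha> \<beta> x \<in> topspace (X \<alpha>)"
  using continuous_map_image_subset_topspace[OF r_cont] by blast

lemma next_less: "is_next \<kappa> \<beta> \<gamma> \<Longrightarrow> (\<beta>, \<gamma>) \<in> \<kappa>"
  and next_neq: "is_next \<kappa> \<beta> \<gamma> \<Longrightarrow> \<beta> \<noteq> \<gamma>"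
  by (auto simp: is_next_def isMinim_def AboveS_def)

lemma first_le: "\<alpha> \<in> Field \<kappa> \<Longrightarrow> (\<zeta>, \<alpha>) \<in> \<kappa>"
  and first_Field: "\<zeta> \<in> Field \<kappa>"
  using first by (auto simp: is_first_def isMinim_def)

lemma first_not_succ: "\<zeta> \<notin> succs"
  using first_le Field(1) next_less next_neq antisym unfolding succs_def by blast

lemma stage_cases:
  assumes "\<delta> \<in> Field \<kappa>"
  obtains "\<delta> = \<zeta>" | \<beta> where "is_next \<kappa> \<beta> \<delta>"
  | "\<delta> \<notin> succs" "\<zeta> \<in> underS \<delta>" "is_sup \<kappa> (underS \<delta>) \<delta>"
proof -
  have "\<exists>\<beta>. is_next \<kappa> \<beta> \<delta>" if "\<delta> \<noteq> \<zeta>" "\<not> is_sup \<kappa> (underS \<delta>) \<delta>"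
  proof -
    have "\<delta> \<in> Above (underS \<delta>)" using assms by (auto simp: Above_def underS_def)
    with that(2) obtain \<beta> where \<beta>: "\<beta> \<in> Above (underS \<delta>)" "(\<delta>, \<beta>) \<notin> \<kappa>"
      by (auto simp: is_sup_def isMinim_def)
    then have "(\<beta>, \<delta>) \<in> \<kappa>" "\<beta> \<noteq> \<delta>" "\<beta> \<in> Field \<kappa>"
      using total[of \<beta> \<delta>] refl[OF assms] assms by (auto simp: Above_def)
    moreover have "(\<delta>, \<alpha>) \<in> \<kappa>" if \<alpha>: "\<alpha> \<in> AboveS {\<beta>}" for \<alpha>
    proof (rule ccontr)
      assume n: "(\<delta>, \<alpha>) \<notin> \<kappa>"
      then have "\<alpha> \<in> underS \<delta>"
        using total[of \<alpha> \<delta>] refl[OF assms] assms \<alpha> by (auto simp: AboveS_def underS_def)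
      then have "(\<alpha>, \<beta>) \<in> \<kappa>" using \<beta>(1) by (auto simp: Above_def)
      then show False using \<alpha> antisym by (auto simp: AboveS_def)
    qed
    ultimately have "is_next \<kappa> \<beta> \<delta>" using assms by (auto simp: is_next_def isMinim_def AboveS_def)
    then show ?thesis by blast
  qed
  then show ?thesis
    using that first_le[OF assms] by (auto simp: succs_def underS_def)
qed

lemma limit_thread:
  assumes "\<delta> \<in> Field \<kappa>" "\<zeta> \<in> underS \<delta>" "is_sup \<kappa> (underS \<delta>) \<delta>"
  shows "homeomorphic_map (X \<delta>) (inverse_limit \<kappa> X r (underS \<delta>))
    (\<lambda>x. restrict (thread \<delta> x) (underS \<delta>))"
proof -
  have "directed_in \<kappa> (underS \<delta>)"
    unfolding directed_in_def
  proof (intro conjI ballI)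
    fix \<alpha> \<beta> assume "\<alpha> \<in> underS \<delta>" "\<beta> \<in> underS \<delta>"
    then show "\<exists>\<gamma>\<in>underS \<delta>. (\<alpha>, \<gamma>) \<in> \<kappa> \<and> (\<beta>, \<gamma>) \<in> \<kappa>"
      using total[of \<alpha> \<beta>] refl Field(1) by (fastforce simp: underS_def)
  qed (use assms Field in \<open>auto simp: underS_def\<close>)
  then show ?thesis
    using cont assms(3) unfolding continuous_sequence_def thread_def by blast
qed

lemma topspace_inverse_limit:
  "z \<in> topspace (inverse_limit \<kappa> X r T) \<longleftrightarrow>
     z \<in> extensional T \<and> (\<forall>\<alpha>\<in>T. z \<alpha> \<in> topspace (X \<alpha>)) \<and>
     (\<forall>\<alpha>\<in>T. \<forall>\<beta>\<in>T. (\<alpha>, \<beta>) \<in> \<kappa> \<longrightarrow> r \<alpha> \<beta> (z \<beta>) = z \<alpha>)"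
  by (auto simp: inverse_limit_def PiE_iff)

lemma projection_cont: "\<alpha> \<in> T \<Longrightarrow> continuous_map (inverse_limit \<kappa> X r T) (X \<alpha>) (\<lambda>z. z \<alpha>)"
  unfolding inverse_limit_def by (intro continuous_map_from_subtopology continuous_map_product_projection)

text \<open>With \<open>\<alpha> = \<zeta>\<close> this is injectivity of the coordinates; in general, uniqueness of lifts.\<close>

lemma eq_if_coords_eq:
  assumes "(\<alpha>, \<delta>) \<in> \<kappa>" "x \<in> topspace (X \<delta>)" "y \<in> topspace (X \<delta>)" "r \<alpha> \<delta> x = r \<alpha> \<delta> y"
    and "\<And>\<gamma> n. \<lbrakk>\<gamma> \<in> succs; (\<alpha>, \<gamma>) \<in> \<kappa>; \<gamma> \<noteq> \<alpha>; (\<gamma>, \<delta>) \<in> \<kappa>\<rbrakk> \<Longrightarrow> c \<gamma> n (r \<gamma> \<delta> x) = c \<gamma> n (r \<gamma> \<delta> y)"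
  shows "x = y"
  using assms
proof (induction \<delta> arbitrary: x y rule: well_order_induct)
  case (1 \<delta>)
  have \<delta>: "\<delta> \<in> Field \<kappa>" using 1(2) by (rule Field)
  have IH: "r \<beta> \<delta> x = r \<beta> \<delta> y" if \<beta>: "(\<beta>, \<delta>) \<in> \<kappa>" "\<beta> \<noteq> \<delta>" "(\<alpha>, \<beta>) \<in> \<kappa>" for \<beta>
  proof -
    have "c \<gamma> n (r \<gamma> \<beta> (r \<beta> \<delta> x)) = c \<gamma> n (r \<gamma> \<beta> (r \<beta> \<delta> y))"
      if "\<gamma> \<in> succs" "(\<alpha>, \<gamma>) \<in> \<kappa>" "\<gamma> \<noteq> \<alpha>" "(\<gamma>, \<beta>) \<in> \<kappa>" for \<gamma> n
      using 1(6)[OF that(1-3) trans[OF that(4) \<beta>(1)]] r_comp[OF that(4) \<beta>(1)] 1(3,4) by simp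
    moreover have "r \<alpha> \<beta> (r \<beta> \<delta> x) = r \<alpha> \<beta> (r \<beta> \<delta> y)"
      using r_comp[OF \<beta>(3,1)] 1(3-5) by simp
    ultimately show ?thesis
      by (intro 1(1)[rule_format, OF conjI[OF \<beta>(2,1)] \<beta>(3) r_in[OF \<beta>(1) 1(3)] r_in[OF \<beta>(1) 1(4)]])
  qed
  show ?case
  proof (cases "\<alpha> = \<delta>")
    case True
    then show ?thesis using 1 r_id[OF \<delta>] by simp
  next
    case False
    from \<delta> show ?thesis
    proof (cases rule: stage_cases)
      case 1
      then show ?thesis using False \<open>(\<alpha>, \<delta>) \<in> \<kappa>\<close> first_le antisym Field by blast
    next
      case (2 \<beta>)
      note \<beta> = next_less[OF 2] next_neq[OF 2] is_next_below[OF 2 \<open>(\<alpha>, \<delta>) \<in> \<kappa>\<close> False]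
      have "\<delta> \<in> succs" using 2 by (auto simp: succs_def)
      then have "c \<delta> n x = c \<delta> n y" for n
        using "1.prems"(5)[of \<delta> n] "1.prems"(1-3) False r_id[OF \<delta>] refl[OF \<delta>] by auto
      then show ?thesis using c_inj[OF 2] IH[OF \<beta>] "1.prems" by blast
    next
      case 3
      have "thread \<delta> x \<beta> = thread \<delta> y \<beta>" if "\<beta> \<in> underS \<delta>" for \<beta>
      proof (cases "(\<alpha>, \<beta>) \<in> \<kappa>")
        case True
        then show ?thesis using IH that by (auto simp: underS_def thread_def)
      next
        case False
        then have "(\<beta>, \<alpha>) \<in> \<kappa>"
          using total[of \<alpha> \<beta>] that Field "1.prems"(1) by (auto simp: underS_def)
        then show ?thesis
          using r_comp[of \<beta> \<alpha> \<delta>] "1.prems"(1-4) by (metis thread_def)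
      qed
      then have "restrict (thread \<delta> x) (underS \<delta>) = restrict (thread \<delta> y) (underS \<delta>)"
        by (rule restrict_ext)
      then show ?thesis
        using homeomorphic_imp_injective_map[OF limit_thread[OF \<delta> 3(2,3)]] "1.prems"(2,3)
        by (auto dest: inj_onD)
    qed
  qed
qed

section \<open>Lifts along the sections\<close>

definition lift :: "'i \<Rightarrow> 'a \<Rightarrow> 'i \<Rightarrow> 'a \<Rightarrow> bool" where
  "lift \<alpha> d \<delta> x \<longleftrightarrow> x \<in> topspace (X \<delta>) \<and> r \<alpha> \<delta> x = d \<and>
     (\<forall>\<gamma>\<in>succs. (\<alpha>, \<gamma>) \<in> \<kappa> \<longrightarrow> \<gamma> \<noteq> \<alpha> \<longrightarrow> (\<gamma>, \<delta>) \<in> \<kappa> \<longrightarrow> (\<forall>n. c \<gamma> n (r \<gamma> \<delta> x) = 0))"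

lemma lift_unique: "(\<alpha>, \<delta>) \<in> \<kappa> \<Longrightarrow> lift \<alpha> d \<delta> x \<Longrightarrow> lift \<alpha> d \<delta> y \<Longrightarrow> x = y"
  by (rule eq_if_coords_eq) (auto simp: lift_def)

lemma lift_restrict:
  assumes "lift \<alpha> d \<delta> x" "(\<alpha>, \<beta>) \<in> \<kappa>" "(\<beta>, \<delta>) \<in> \<kappa>"
  shows "lift \<alpha> d \<beta> (r \<beta> \<delta> x)"
  using assms trans r_comp r_in unfolding lift_def by (metis (no_types, lifting))

lemma limit_lift:
  assumes T: "ofilter T" "\<alpha> \<in> T" and d: "d \<in> topspace (X \<alpha>)"
    and ex: "\<And>\<beta>. \<beta> \<in> T \<Longrightarrow> (\<alpha>, \<beta>) \<in> \<kappa> \<Longrightarrow> \<exists>x. lift \<alpha> d \<beta> x"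
  shows "\<exists>z\<in>topspace (inverse_limit \<kappa> X r T). z \<alpha> = d \<and>
    (\<forall>\<gamma>\<in>T \<inter> succs. (\<alpha>, \<gamma>) \<in> \<kappa> \<longrightarrow> \<gamma> \<noteq> \<alpha> \<longrightarrow> (\<forall>n. c \<gamma> n (z \<gamma>) = 0))"
proof -
  have TF: "\<beta> \<in> Field \<kappa>" if "\<beta> \<in> T" for \<beta> using T(1) that by (auto simp: ofilter_def)
  obtain f where f: "\<And>\<beta>. \<beta> \<in> T \<Longrightarrow> (\<alpha>, \<beta>) \<in> \<kappa> \<Longrightarrow> lift \<alpha> d \<beta> (f \<beta>)" using ex by metis
  define z where "z = (\<lambda>\<beta>\<in>T. if (\<alpha>, \<beta>) \<in> \<kappa> then f \<beta> else r \<beta> \<alpha> d)"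
  have \<alpha>: "(\<alpha>, \<alpha>) \<in> \<kappa>" using refl TF T(2) by blast
  have f\<alpha>: "f \<alpha> = d" using f[OF T(2) \<alpha>] r_id[OF TF[OF T(2)]] by (auto simp: lift_def)
  have le: "(\<beta>, \<alpha>) \<in> \<kappa>" if "\<beta> \<in> T" "(\<alpha>, \<beta>) \<notin> \<kappa>" for \<beta> using total TF T(2) that by blast
  show ?thesis
  proof (intro bexI conjI ballI impI allI)
    show "z \<in> topspace (inverse_limit \<kappa> X r T)"
      unfolding topspace_inverse_limit
    proof (intro conjI ballI impI)
      show "z \<in> extensional T" by (simp add: z_def)
      show "z \<beta> \<in> topspace (X \<beta>)" if "\<beta> \<in> T" for \<beta>
        using f[OF that] r_in[OF le[OF that] d] that by (auto simp: z_def lift_def)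
      show "r \<beta> \<gamma> (z \<gamma>) = z \<beta>" if "\<beta> \<in> T" "\<gamma> \<in> T" "(\<beta>, \<gamma>) \<in> \<kappa>" for \<beta> \<gamma>
      proof (cases "(\<alpha>, \<beta>) \<in> \<kappa>")
        case True
        note \<gamma> = trans[OF True that(3)]
        have "r \<beta> \<gamma> (f \<gamma>) = f \<beta>"
          using lift_unique[OF True lift_restrict[OF f[OF that(2) \<gamma>] True that(3)] f[OF that(1) True]] .
        then show ?thesis using True \<gamma> that by (simp add: z_def)
      next
        case False
        note \<beta> = le[OF that(1) False]
        show ?thesis
        proof (cases "(\<alpha>, \<gamma>) \<in> \<kappa>")
          case True
          then have "r \<beta> \<gamma> (f \<gamma>) = r \<beta> \<alpha> d"
            using f[OF that(2) True] r_comp[OF \<beta> True, of "f \<gamma>"] by (auto simp: lift_def)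
          then show ?thesis using True False that by (simp add: z_def)
        next
          case False
          then show ?thesis
            using \<open>(\<alpha>, \<beta>) \<notin> \<kappa>\<close> that r_comp[OF that(3) le[OF that(2) False] d] by (simp add: z_def)
        qed
      qed
    qed
    show "z \<alpha> = d" using T(2) \<alpha> f\<alpha> by (simp add: z_def)
    show "c \<gamma> n (z \<gamma>) = 0" if "\<gamma> \<in> T \<inter> succs" "(\<alpha>, \<gamma>) \<in> \<kappa>" "\<gamma> \<noteq> \<alpha>" for \<gamma> n
      using f[of \<gamma>] that r_id[of \<gamma> "f \<gamma>"] refl[of \<gamma>] TF[of \<gamma>] by (auto simp: lift_def z_def)
  qed
qed

lemma lift_exists: "(\<alpha>, \<delta>) \<in> \<kappa> \<Longrightarrow> d \<in> topspace (X \<alpha>) \<Longrightarrow> \<exists>x. lift \<alpha> d \<delta> x"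
proof (induction \<delta> rule: well_order_induct)
  case (1 \<delta>)
  have \<delta>: "\<delta> \<in> Field \<kappa>" and \<alpha>: "\<alpha> \<in> Field \<kappa>" using "1.prems"(1) by (auto dest: Field)
  show ?case
  proof (cases "\<alpha> = \<delta>")
    case True
    then have "lift \<alpha> d \<delta> d" using "1.prems" r_id[OF \<delta>] antisym by (auto simp: lift_def)
    then show ?thesis by blast
  next
    case False
    from \<delta> show ?thesis
    proof (cases rule: stage_cases)
      case 1
      then show ?thesis using False "1.prems"(1) first_le[OF \<alpha>] antisym by blast
    next
      case (2 \<beta>)
      note \<beta> = next_less[OF 2] next_neq[OF 2] is_next_below[OF 2 "1.prems"(1) False]
      obtain y where y: "lift \<alpha> d \<beta> y" using "1.IH" \<beta> "1.prems"(2) by blast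
      then obtain x where x: "x \<in> topspace (X \<delta>)" "r \<beta> \<delta> x = y" "\<And>n. c \<delta> n x = 0"
        using c_zero[OF 2, of y] by (auto simp: lift_def)
      have "c \<gamma> n (r \<gamma> \<delta> x) = 0" if "\<gamma> \<in> succs" "(\<alpha>, \<gamma>) \<in> \<kappa>" "\<gamma> \<noteq> \<alpha>" "(\<gamma>, \<delta>) \<in> \<kappa>" for \<gamma> n
      proof (cases "\<gamma> = \<delta>")
        case True
        then show ?thesis using x r_id[OF \<delta>] by simp
      next
        case False
        note \<gamma> = is_next_below[OF 2 that(4) False]
        then show ?thesis using y that r_comp[OF \<gamma> \<beta>(1) x(1)] x(2) by (auto simp: lift_def)
      qed
      moreover have "r \<alpha> \<delta> x = d" using r_comp[OF \<beta>(3,1) x(1)] x(2) y by (simp add: lift_def)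
      ultimately have "lift \<alpha> d \<delta> x" using x(1) by (auto simp: lift_def)
      then show ?thesis by blast
    next
      case 3
      let ?T = "underS \<delta>"
      have \<alpha>T: "\<alpha> \<in> ?T" using False "1.prems"(1) by (simp add: underS_def)
      have ex: "\<exists>x. lift \<alpha> d \<beta> x" if "\<beta> \<in> ?T" "(\<alpha>, \<beta>) \<in> \<kappa>" for \<beta>
        using "1.IH" "1.prems"(2) that by (auto simp: underS_def)
      obtain z where z: "z \<in> topspace (inverse_limit \<kappa> X r ?T)" "z \<alpha> = d"
        "\<forall>\<gamma>\<in>?T \<inter> succs. (\<alpha>, \<gamma>) \<in> \<kappa> \<longrightarrow> \<gamma> \<noteq> \<alpha> \<longrightarrow> (\<forall>n. c \<gamma> n (z \<gamma>) = 0)"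
        using limit_lift[OF underS_ofilter \<alpha>T "1.prems"(2) ex] by blast
      obtain x where x: "x \<in> topspace (X \<delta>)" "z = restrict (thread \<delta> x) ?T"
        using z(1) homeomorphic_imp_surjective_map[OF limit_thread[OF \<delta> 3(2,3)]] by blast
      have zx: "z \<beta> = r \<beta> \<delta> x" if "\<beta> \<in> ?T" for \<beta> using x(2) that by (simp add: thread_def)
      have "\<gamma> \<in> ?T" if "\<gamma> \<in> succs" "(\<gamma>, \<delta>) \<in> \<kappa>" for \<gamma> using that 3(1) by (auto simp: underS_def)
      then have "lift \<alpha> d \<delta> x" using x(1) z(2,3) zx \<alpha>T by (fastforce simp: lift_def)
      then show ?thesis by blast
    qed
  qed
qed

section \<open>Density of the points of countable support\<close>

lemma inverse_limit_basis:
  assumes T: "ofilter T" "T \<noteq> {}" and U: "openin (inverse_limit \<kappa> X r T) U" "U \<noteq> {}"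
  obtains \<alpha> V where "\<alpha> \<in> T" "openin (X \<alpha>) V" "V \<noteq> {}"
    "\<And>z. z \<in> topspace (inverse_limit \<kappa> X r T) \<Longrightarrow> z \<alpha> \<in> V \<Longrightarrow> z \<in> U"
proof -
  have TF: "\<beta> \<in> Field \<kappa>" if "\<beta> \<in> T" for \<beta> using T(1) that by (auto simp: ofilter_def)
  obtain p where p: "p \<in> U" using U(2) by blast
  have pL: "p \<in> topspace (inverse_limit \<kappa> X r T)" using openin_subset[OF U(1)] p by blast
  obtain W where W: "openin (product_topology X T) W" "U = W \<inter> topspace (inverse_limit \<kappa> X r T)"
  proof -
    obtain W where W: "openin (product_topology X T) W" "U = W \<inter> {x. \<forall>\<alpha>\<in>T. \<forall>\<beta>\<in>T. (\<alpha>, \<beta>) \<in> \<kappa> \<longrightarrow> r \<alpha> \<beta> (x \<beta>) = x \<alpha>}"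
      using U(1) unfolding inverse_limit_def openin_subtopology by blast
    moreover have "W \<subseteq> topspace (product_topology X T)" using W(1) by (rule openin_subset)
    ultimately have "U = W \<inter> topspace (inverse_limit \<kappa> X r T)"
      unfolding inverse_limit_def topspace_subtopology by blast
    with W(1) show ?thesis by (rule that)
  qed
  then obtain V where V: "finite {\<beta> \<in> T. V \<beta> \<noteq> topspace (X \<beta>)}" "\<And>\<beta>. \<beta> \<in> T \<Longrightarrow> openin (X \<beta>) (V \<beta>)"
      "p \<in> PiE T V" "PiE T V \<subseteq> W"
    using p unfolding openin_product_topology_alt by (auto 0 3)
  let ?F = "{\<beta> \<in> T. V \<beta> \<noteq> topspace (X \<beta>)}"
  have "\<exists>\<alpha>\<in>T. \<forall>\<beta>\<in>F. (\<beta>, \<alpha>) \<in> \<kappa>" if "finite F" "F \<subseteq> T" for F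
    using that
  proof (induction F rule: finite_induct)
    case empty
    then show ?case using T(2) by blast
  next
    case (insert \<beta> F)
    then obtain \<alpha> where \<alpha>: "\<alpha> \<in> T" "\<forall>\<beta>\<in>F. (\<beta>, \<alpha>) \<in> \<kappa>" by auto
    show ?case
    proof (cases "(\<beta>, \<alpha>) \<in> \<kappa>")
      case True
      then show ?thesis using \<alpha> by blast
    next
      case False
      then have "(\<alpha>, \<beta>) \<in> \<kappa>" using total[of \<alpha> \<beta>] TF \<alpha> insert.prems by blast
      moreover have "\<beta> \<in> T" "(\<beta>, \<beta>) \<in> \<kappa>" using refl TF insert.prems by auto
      ultimately show ?thesis using \<alpha>(2) trans by (intro bexI[of _ \<beta>]) auto
    qed
  qed
  from this[OF V(1)] obtain \<alpha> where \<alpha>: "\<alpha> \<in> T" "\<forall>\<beta>\<in>?F. (\<beta>, \<alpha>) \<in> \<kappa>" by blast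
  let ?V = "topspace (X \<alpha>) \<inter> (\<Inter>\<beta>\<in>?F. {x \<in> topspace (X \<alpha>). r \<beta> \<alpha> x \<in> V \<beta>})"
  show ?thesis
  proof
    show "\<alpha> \<in> T" by fact
    have "openin (X \<alpha>) {x \<in> topspace (X \<alpha>). r \<beta> \<alpha> x \<in> V \<beta>}" if "\<beta> \<in> ?F" for \<beta>
      using openin_continuous_map_preimage[OF r_cont V(2)] \<alpha>(2) that by blast
    then have "openin (X \<alpha>) ((\<Inter>\<beta>\<in>?F. {x \<in> topspace (X \<alpha>). r \<beta> \<alpha> x \<in> V \<beta>}) \<inter> topspace (X \<alpha>))"
      by (rule openin_INT[OF V(1)])
    then show "openin (X \<alpha>) ?V" by (simp only: Int_commute)
    have "p \<alpha> \<in> ?V" using pL \<alpha> V(3) by (auto simp: topspace_inverse_limit PiE_iff)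
    then show "?V \<noteq> {}" by blast
    show "z \<in> U" if z: "z \<in> topspace (inverse_limit \<kappa> X r T)" "z \<alpha> \<in> ?V" for z
    proof -
      have "z \<beta> \<in> V \<beta>" if "\<beta> \<in> T" for \<beta>
      proof (cases "\<beta> \<in> ?F")
        case True
        then show ?thesis using z \<alpha> that by (auto simp: topspace_inverse_limit)
      next
        case False
        then show ?thesis using z that by (auto simp: topspace_inverse_limit)
      qed
      then have "z \<in> PiE T V" using z(1) by (simp add: topspace_inverse_limit PiE_iff)
      then show ?thesis using z(1) V(4) W(2) by blast
    qed
  qed
qed

lemma limit_dense:
  assumes T: "ofilter T" "T \<noteq> {}"
    and dense: "\<And>\<alpha> V. \<alpha> \<in> T \<Longrightarrow> openin (X \<alpha>) V \<Longrightarrow> V \<noteq> {} \<Longrightarrow>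
      \<exists>x\<in>V. countable (support (under \<alpha>) (thread \<alpha> x))"
    and U: "openin (inverse_limit \<kappa> X r T) U" "U \<noteq> {}"
  shows "\<exists>z\<in>U. countable (support T z)"
proof -
  obtain \<alpha> V where \<alpha>: "\<alpha> \<in> T" "openin (X \<alpha>) V" "V \<noteq> {}"
    and V: "\<And>z. z \<in> topspace (inverse_limit \<kappa> X r T) \<Longrightarrow> z \<alpha> \<in> V \<Longrightarrow> z \<in> U"
    using inverse_limit_basis[OF T U] by metis
  obtain d where d: "d \<in> V" "countable (support (under \<alpha>) (thread \<alpha> d))"
    using dense[OF \<alpha>] by blast
  have dX: "d \<in> topspace (X \<alpha>)" using openin_subset[OF \<alpha>(2)] d(1) by blast
  obtain z where z: "z \<in> topspace (inverse_limit \<kappa> X r T)" "z \<alpha> = d"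
    "\<forall>\<gamma>\<in>T \<inter> succs. (\<alpha>, \<gamma>) \<in> \<kappa> \<longrightarrow> \<gamma> \<noteq> \<alpha> \<longrightarrow> (\<forall>n. c \<gamma> n (z \<gamma>) = 0)"
    using limit_lift[OF T(1) \<alpha>(1) dX lift_exists[OF _ dX]] by blast
  have TF: "\<beta> \<in> Field \<kappa>" if "\<beta> \<in> T" for \<beta> using T(1) that by (auto simp: ofilter_def)
  have below: "\<beta> \<in> T \<and> z \<beta> = thread \<alpha> d \<beta>" if "(\<beta>, \<alpha>) \<in> \<kappa>" for \<beta>
  proof -
    have "\<beta> \<in> T" using that \<alpha>(1) T(1) by (auto simp: ofilter_def under_def)
    moreover from this have "r \<beta> \<alpha> (z \<alpha>) = z \<beta>"
      using z(1) that \<alpha>(1) unfolding topspace_inverse_limit by blast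
    ultimately show ?thesis using z(2) by (simp add: thread_def)
  qed
  have "support T z \<subseteq> support (under \<alpha>) (thread \<alpha> d)"
  proof
    fix j assume j: "j \<in> support T z"
    show "j \<in> support (under \<alpha>) (thread \<alpha> d)"
    proof (cases j)
      case (Inl t)
      then show ?thesis
        using j below[OF first_le[OF TF[OF \<alpha>(1)]]] by (auto simp: support_def coords_def)
    next
      case (Inr p)
      obtain \<gamma> n where p: "p = (\<gamma>, n)" by fastforce
      have \<gamma>: "\<gamma> \<in> T \<inter> succs" "c \<gamma> n (z \<gamma>) \<noteq> 0" using j Inr p by (auto simp: support_def coords_def)
      then have "(\<alpha>, \<gamma>) \<in> \<kappa> \<Longrightarrow> \<gamma> = \<alpha>" using z(3) by blast
      then have "(\<gamma>, \<alpha>) \<in> \<kappa>" using \<gamma>(1) total[of \<gamma> \<alpha>] refl[of \<alpha>] TF \<alpha>(1) by blast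
      then show ?thesis using \<gamma> below[of \<gamma>] Inr p by (auto simp: support_def coords_def under_def)
    qed
  qed
  then have "countable (support T z)" using d(2) by (rule countable_subset)
  moreover have "z \<in> U" using V[OF z(1)] z(2) d(1) by simp
  ultimately show ?thesis by blast
qed

lemma h_homeomorphic:
    "homeomorphic_map (X \<zeta>) (subtopology (tikhonov_cube T\<^sub>0) (h ` topspace (X \<zeta>))) h"
  and h_closure:
    "h ` topspace (X \<zeta>) = tikhonov_cube T\<^sub>0 closure_of (Sigma_product T\<^sub>0 \<inter> h ` topspace (X \<zeta>))"
  using h unfolding Valdivia_embedding_def embedding_map_def by blast+

lemma coord_cont:
  assumes T: "T \<subseteq> Field \<kappa>" "\<zeta> \<in> T" and j: "j \<in> coords T"
    and p: "\<And>\<alpha>. \<alpha> \<in> T \<Longrightarrow> continuous_map Y (X \<alpha>) (\<lambda>y. p y \<alpha>)"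
  shows "continuous_map Y (top_of_set {0..1}) (\<lambda>y. coord (p y) j)"
proof (cases j)
  case (Inl t)
  have "continuous_map (X \<zeta>) (tikhonov_cube T\<^sub>0) h"
    using homeomorphic_imp_continuous_map[OF h_homeomorphic] by (simp add: continuous_map_in_subtopology)
  moreover have "t \<in> T\<^sub>0" using j Inl by (auto simp: coords_def)
  ultimately have "continuous_map (X \<zeta>) (top_of_set {0..1}) (\<lambda>x. h x t)"
    unfolding tikhonov_cube_def continuous_map_componentwise by (elim conjE bspec)
  from continuous_map_compose[OF p[OF T(2)] this] show ?thesis using Inl by (simp add: comp_def)
next
  case (Inr q)
  then obtain \<gamma> n where q: "j = Inr (\<gamma>, n)" by (cases q) auto
  then have \<gamma>: "\<gamma> \<in> T" "\<gamma> \<in> succs" using j by (auto simp: coords_def)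
  then obtain \<beta> where "is_next \<kappa> \<beta> \<gamma>" by (auto simp: succs_def)
  from continuous_map_compose[OF p[OF \<gamma>(1)] c_cont[OF this, of n]] show ?thesis
    using q by (simp add: comp_def)
qed

lemma stage_dense:
  assumes "\<delta> \<in> Field \<kappa>" "openin (X \<delta>) U" "U \<noteq> {}"
  shows "\<exists>x\<in>U. countable (support (under \<delta>) (thread \<delta> x))"
  using assms
proof (induction \<delta> arbitrary: U rule: well_order_induct)
  case (1 \<delta>)
  have IH: "\<exists>x\<in>V. countable (support (under \<alpha>) (thread \<alpha> x))"
    if "(\<alpha>, \<delta>) \<in> \<kappa>" "\<alpha> \<noteq> \<delta>" "openin (X \<alpha>) V" "V \<noteq> {}" for \<alpha> V
    by (rule 1(1)[rule_format, OF conjI[OF that(2,1)] Field(1)[OF that(1)] that(3,4)])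
  have UX: "U \<subseteq> topspace (X \<delta>)" using "1.prems"(2) by (rule openin_subset)
  from "1.prems"(1) show ?case
  proof (cases rule: stage_cases)
    case 1
    let ?C = "tikhonov_cube T\<^sub>0"
    have hom: "homeomorphic_map (X \<delta>) (subtopology ?C (h ` topspace (X \<delta>))) h"
      and cl: "h ` topspace (X \<delta>) = ?C closure_of (Sigma_product T\<^sub>0 \<inter> h ` topspace (X \<delta>))"
      unfolding 1 by (rule h_homeomorphic, rule h_closure)
    have "openin (subtopology ?C (h ` topspace (X \<delta>))) (h ` U)"
      using homeomorphic_map_openness_eq[OF hom] "1.prems"(2) by blast
    then obtain W where W: "openin ?C W" "h ` U = W \<inter> h ` topspace (X \<delta>)"
      unfolding openin_subtopology by blast
    obtain u where u: "u \<in> U" using "1.prems"(3) by blast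
    have "h u \<in> ?C closure_of (Sigma_product T\<^sub>0 \<inter> h ` topspace (X \<delta>))"
      by (rule subsetD[OF equalityD1[OF cl]]) (use u UX in blast)
    moreover have "h u \<in> W" using u W(2) by blast
    ultimately obtain y where y: "y \<in> Sigma_product T\<^sub>0" "y \<in> h ` topspace (X \<delta>)" "y \<in> W"
      using W(1) unfolding in_closure_of by blast
    then have "y \<in> h ` U" using W(2) by blast
    then obtain x where x: "x \<in> U" "h x \<in> Sigma_product T\<^sub>0" using y(1) by blast
    have "under \<delta> \<inter> succs = {}"
    proof -
      have "\<gamma> = \<zeta>" if "(\<gamma>, \<zeta>) \<in> \<kappa>" for \<gamma>
        using antisym[OF that first_le[OF Field(1)[OF that]]] .
      then show ?thesis using 1 first_not_succ by (auto simp: under_def)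
    qed
    moreover have "r \<zeta> \<delta> x = x" using r_id[OF first_Field] x(1) UX 1 by blast
    ultimately have "support (under \<delta>) (thread \<delta> x) = Inl ` {t \<in> T\<^sub>0. h x t \<noteq> 0}"
      by (auto simp: support_def coords_def thread_def)
    moreover have "countable {t \<in> T\<^sub>0. h x t \<noteq> 0}" using x(2) by (simp add: Sigma_product_def)
    ultimately have "countable (support (under \<delta>) (thread \<delta> x))" by simp
    then show ?thesis using x(1) by blast
  next
    case (2 \<beta>)
    note \<beta> = next_less[OF 2] next_neq[OF 2]
    have \<beta>F: "\<beta> \<in> Field \<kappa>" using \<beta>(1) by (rule Field)
    obtain G where G: "gdelta_in (X \<beta>) G" "G \<noteq> {}" "G \<subseteq> r \<beta> \<delta> ` U"
      using gdelta_image[OF 2 "1.prems"(2,3)] by blast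
    have "\<exists>y\<in>G. countable {j \<in> coords (under \<beta>). coord (thread \<beta> y) j \<noteq> 0}"
    proof (rule dense_countable_support_meets_gdelta[OF compact[OF \<beta>F] Hausdorff[OF \<beta>F] _ _ G(1,2)])
      show "continuous_map (X \<beta>) euclideanreal (\<lambda>y. coord (thread \<beta> y) j)"
        if "j \<in> coords (under \<beta>)" for j
        by (rule continuous_map_into_fulltopology, rule coord_cont[OF under_Field _ that])
          (auto simp: thread_def under_def first_le[OF \<beta>F] intro: r_cont)
      show "\<exists>y\<in>V. countable {j \<in> coords (under \<beta>). coord (thread \<beta> y) j \<noteq> 0}"
        if "openin (X \<beta>) V" "V \<noteq> {}" for V
        using IH[OF \<beta> that] by (simp add: support_def)
    qed
    then obtain x where x: "x \<in> U" "countable (support (under \<beta>) (thread \<beta> (r \<beta> \<delta> x)))"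
      using G(3) unfolding support_def by blast
    have "support (under \<delta>) (thread \<delta> x) \<subseteq>
        support (under \<beta>) (thread \<beta> (r \<beta> \<delta> x)) \<union> Inr ` ({\<delta>} \<times> UNIV)"
    proof
      fix j assume j: "j \<in> support (under \<delta>) (thread \<delta> x)"
      have thr: "thread \<beta> (r \<beta> \<delta> x) \<gamma> = thread \<delta> x \<gamma>" if "(\<gamma>, \<beta>) \<in> \<kappa>" for \<gamma>
        using r_comp[OF that \<beta>(1)] x(1) UX by (auto simp: thread_def)
      show "j \<in> support (under \<beta>) (thread \<beta> (r \<beta> \<delta> x)) \<union> Inr ` ({\<delta>} \<times> UNIV)"
      proof (cases j)
        case (Inl t)
        then show ?thesis using j thr[OF first_le[OF \<beta>F]] by (auto simp: support_def coords_def)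
      next
        case (Inr p)
        obtain \<gamma> n where p: "p = (\<gamma>, n)" by fastforce
        show ?thesis
        proof (cases "\<gamma> = \<delta>")
          case True
          then show ?thesis using Inr p by simp
        next
          case False
          moreover have \<gamma>: "(\<gamma>, \<delta>) \<in> \<kappa>" "\<gamma> \<in> succs" "c \<gamma> n (thread \<delta> x \<gamma>) \<noteq> 0"
            using j Inr p by (auto simp: support_def coords_def under_def)
          ultimately have "(\<gamma>, \<beta>) \<in> \<kappa>" using is_next_below[OF 2] by blast
          then show ?thesis using \<gamma> thr[of \<gamma>] Inr p by (auto simp: support_def coords_def under_def)
        qed
      qed
    qed
    moreover have "countable (support (under \<beta>) (thread \<beta> (r \<beta> \<delta> x)) \<union> Inr ` ({\<delta>} \<times> UNIV))"
      using x(2) by (intro countable_Un countable_image countable_SIGMA) auto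
    ultimately have "countable (support (under \<delta>) (thread \<delta> x))" by (rule countable_subset)
    then show ?thesis using x(1) by blast
  next
    case 3
    let ?T = "underS \<delta>" and ?f = "\<lambda>x. restrict (thread \<delta> x) (underS \<delta>)"
    note hom = limit_thread[OF "1.prems"(1) 3(2,3)]
    have "openin (inverse_limit \<kappa> X r ?T) (?f ` U)"
      using homeomorphic_map_openness_eq[OF hom] "1.prems"(2) by blast
    moreover have "?f ` U \<noteq> {}" using "1.prems"(3) by blast
    moreover have "\<exists>x\<in>V. countable (support (under \<alpha>) (thread \<alpha> x))"
      if "\<alpha> \<in> ?T" "openin (X \<alpha>) V" "V \<noteq> {}" for \<alpha> V
      using IH[OF _ _ that(2,3)] that(1) by (simp add: underS_def)
    moreover have "?T \<noteq> {}" using 3(2) by blast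
    ultimately have "\<exists>z\<in>?f ` U. countable (support ?T z)"
      by (intro limit_dense[OF underS_ofilter])
    then obtain x where x: "x \<in> U" "countable (support ?T (?f x))" by blast
    have "support (under \<delta>) (thread \<delta> x) = support ?T (?f x)"
      using 3(1,2) by (auto simp: support_def coords_def under_def underS_def split: if_splits)
    with x(2) have "countable (support (under \<delta>) (thread \<delta> x))" by simp
    then show ?thesis using x(1) by blast
  qed
qed

lemma Valdivia_compact_inverse_limit: "Valdivia_compact (inverse_limit \<kappa> X r (Field \<kappa>))"
proof -
  let ?L = "inverse_limit \<kappa> X r (Field \<kappa>)" and ?J = "coords (Field \<kappa>)"
  let ?P = "product_topology X (Field \<kappa>)" and ?C = "tikhonov_cube (coords (Field \<kappa>))"
  define H where "H z = restrict (coord z) ?J" for z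
  let ?E = "\<lambda>\<alpha> \<beta>. {z \<in> topspace ?P. r \<alpha> \<beta> (z \<beta>) = z \<alpha>}"
  have P: "compact_space ?P" "Hausdorff_space ?P"
    using compact Hausdorff by (auto simp: compact_space_product_topology Hausdorff_space_product_topology)
  have E: "closedin ?P (?E \<alpha> \<beta>)" if ab: "(\<alpha>, \<beta>) \<in> \<kappa>" for \<alpha> \<beta>
  proof (rule closedin_continuous_maps_eq[OF Hausdorff[OF Field(1)[OF ab]]])
    have "continuous_map ?P (X \<beta>) (\<lambda>z. z \<beta>)"
      by (rule continuous_map_product_projection) (rule Field(2)[OF ab])
    from continuous_map_compose[OF this r_cont[OF ab]]
    show "continuous_map ?P (X \<alpha>) (\<lambda>z. r \<alpha> \<beta> (z \<beta>))" by (simp add: comp_def)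
    show "continuous_map ?P (X \<alpha>) (\<lambda>z. z \<alpha>)"
      by (rule continuous_map_product_projection) (rule Field(1)[OF ab])
  qed
  let ?F = "insert (topspace ?P) {?E \<alpha> \<beta> |\<alpha> \<beta>. (\<alpha>, \<beta>) \<in> \<kappa>}"
  have "closedin ?P (\<Inter>?F)"
    by (rule closedin_Inter) (use E closedin_topspace in blast)+
  moreover have "z \<in> \<Inter>?F \<longleftrightarrow> z \<in> topspace ?L" for z
  proof -
    have "z \<in> \<Inter>?F \<longleftrightarrow> z \<in> topspace ?P \<and> (\<forall>\<alpha> \<beta>. (\<alpha>, \<beta>) \<in> \<kappa> \<longrightarrow> r \<alpha> \<beta> (z \<beta>) = z \<alpha>)" by blast
    also have "\<dots> \<longleftrightarrow> z \<in> topspace ?L"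
      unfolding inverse_limit_def topspace_subtopology using Field by blast
    finally show ?thesis .
  qed
  then have "\<Inter>?F = topspace ?L" by (rule set_eqI)
  ultimately have L_closed: "closedin ?P (topspace ?L)" by (simp only:)
  have L_eq: "?L = subtopology ?P (topspace ?L)"
    unfolding inverse_limit_def topspace_subtopology by (rule subtopology_restrict[symmetric])
  have compact_L: "compact_space ?L"
    by (subst L_eq) (rule compact_space_subtopology[OF closedin_compact_space[OF P(1) L_closed]])
  have Hausdorff_L: "Hausdorff_space ?L"
    using P(2) by (simp add: inverse_limit_def Hausdorff_space_subtopology)
  have H_cont: "continuous_map ?L ?C H"
    unfolding tikhonov_cube_def continuous_map_componentwise
  proof (intro conjI ballI)
    fix j assume j: "j \<in> ?J"
    have "continuous_map ?L (top_of_set {0..1}) (\<lambda>z. coord z j)"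
      by (rule coord_cont[OF subset_refl first_Field j]) (rule projection_cont)
    then show "continuous_map ?L (top_of_set {0..1}) (\<lambda>z. H z j)" using j by (simp add: H_def)
  qed (auto simp: H_def)
  have H_inj: "inj_on H (topspace ?L)"
  proof (rule inj_onI)
    fix x y assume xy: "x \<in> topspace ?L" "y \<in> topspace ?L" "H x = H y"
    have eq: "coord x j = coord y j" if "j \<in> ?J" for j
      using fun_cong[OF xy(3), of j] that by (simp add: H_def)
    have h_inj: "inj_on h (topspace (X \<zeta>))"
      by (rule homeomorphic_imp_injective_map[OF h_homeomorphic])
    have h_ext: "h ` topspace (X \<zeta>) \<subseteq> topspace (tikhonov_cube T\<^sub>0)"
      by (subst h_closure) (rule closure_of_subset_topspace)
    have \<zeta>: "x \<zeta> \<in> topspace (X \<zeta>)" "y \<zeta> \<in> topspace (X \<zeta>)"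
      using xy first_Field by (auto simp: topspace_inverse_limit)
    have "h (x \<zeta>) = h (y \<zeta>)"
    proof (rule extensionalityI[of _ T\<^sub>0])
      show "h (x \<zeta>) t = h (y \<zeta>) t" if "t \<in> T\<^sub>0" for t
        using eq[of "Inl t"] that by (auto simp: coords_def)
    qed (use h_ext \<zeta> in \<open>auto simp: tikhonov_cube_def PiE_iff\<close>)
    then have x\<zeta>: "x \<zeta> = y \<zeta>" using h_inj \<zeta> by (auto dest: inj_onD)
    have "x \<delta> = y \<delta>" if \<delta>: "\<delta> \<in> Field \<kappa>" for \<delta>
    proof (rule eq_if_coords_eq[OF first_le[OF \<delta>]])
      show "r \<zeta> \<delta> (x \<delta>) = r \<zeta> \<delta> (y \<delta>)"
        using xy(1,2) \<delta> first_Field first_le[OF \<delta>] x\<zeta> by (auto simp: topspace_inverse_limit)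
      show "c \<gamma> n (r \<gamma> \<delta> (x \<delta>)) = c \<gamma> n (r \<gamma> \<delta> (y \<delta>))" if "\<gamma> \<in> succs" "(\<gamma>, \<delta>) \<in> \<kappa>" for \<gamma> n
        using xy(1,2) \<delta> that Field(1)[OF that(2)] eq[of "Inr (\<gamma>, n)"]
        by (auto simp: topspace_inverse_limit coords_def)
    qed (use xy \<delta> in \<open>auto simp: topspace_inverse_limit\<close>)
    then show "x = y"
      using xy(1,2) by (intro extensionalityI[of _ "Field \<kappa>"]) (auto simp: topspace_inverse_limit)
  qed
  have "Hausdorff_space ?C"
    unfolding tikhonov_cube_def by (simp add: Hausdorff_space_product_topology Hausdorff_space_subtopology)
  then have H_closed: "closed_map ?L ?C H"
    using compact_L H_cont by (simp add: continuous_imp_closed_map_gen Hausdorff_imp_kc_space)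
  have "H ` topspace ?L = ?C closure_of (Sigma_product ?J \<inter> H ` topspace ?L)"
  proof
    show "?C closure_of (Sigma_product ?J \<inter> H ` topspace ?L) \<subseteq> H ` topspace ?L"
      using H_closed by (intro closure_of_minimal) (auto simp: closed_map_def)
    show "H ` topspace ?L \<subseteq> ?C closure_of (Sigma_product ?J \<inter> H ` topspace ?L)"
    proof
      fix y assume "y \<in> H ` topspace ?L"
      then obtain x where x: "x \<in> topspace ?L" "y = H x" by blast
      have HC: "H z \<in> topspace ?C" if "z \<in> topspace ?L" for z
        using continuous_map_image_subset_topspace[OF H_cont] that by blast
      show "y \<in> ?C closure_of (Sigma_product ?J \<inter> H ` topspace ?L)"
        unfolding in_closure_of
      proof (intro conjI allI impI)
        show "y \<in> topspace ?C" using HC x by blast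
        fix W assume W: "y \<in> W \<and> openin ?C W"
        let ?U = "{z \<in> topspace ?L. H z \<in> W}"
        have "openin ?L ?U" using openin_continuous_map_preimage[OF H_cont] W by blast
        moreover have "?U \<noteq> {}" using x W by blast
        moreover have "Field \<kappa> \<noteq> {}" using first_Field by blast
        ultimately have "\<exists>z\<in>?U. countable (support (Field \<kappa>) z)"
          by (intro limit_dense[OF Field_ofilter _ stage_dense])
        then obtain z where z: "z \<in> ?U" "countable (support (Field \<kappa>) z)" ..
        have "{j \<in> ?J. H z j \<noteq> 0} = support (Field \<kappa>) z" by (auto simp: H_def support_def)
        then have "H z \<in> Sigma_product ?J" using z HC by (auto simp: Sigma_product_def)
        then show "\<exists>y. y \<in> Sigma_product ?J \<inter> H ` topspace ?L \<and> y \<in> W" using z(1) by blast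
      qed
    qed
  qed
  with injective_closed_imp_embedding_map[OF H_cont H_closed H_inj] have "Valdivia_embedding ?L ?J H"
    unfolding Valdivia_embedding_def by (rule conjI)
  then show ?thesis by (rule Valdivia_compactI[OF compact_L Hausdorff_L])
qed

end

theorem theorem4p2:
  fixes \<kappa> :: "'i rel"
    and X :: "'i \<Rightarrow> 'a topology"
    and r :: "'i \<Rightarrow> 'i \<Rightarrow> 'a \<Rightarrow> 'a"
  assumes "Well_order \<kappa>" and "Field \<kappa> \<noteq> {}"
    and "inverse_sequence \<kappa> X r"
    and "continuous_sequence \<kappa> X r"
    and "\<And>\<zeta>. is_first \<kappa> \<zeta> \<Longrightarrow> Valdivia_compact (X \<zeta>)"
    and "\<And>\<alpha> \<beta>. is_next \<kappa> \<alpha> \<beta> \<Longrightarrow> simple_retraction (X \<beta>) (X \<alpha>) (r \<alpha> \<beta>)"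
  shows "Valdivia_compact (inverse_limit \<kappa> X r (Field \<kappa>))"
proof -
  interpret wo_rel \<kappa> using assms(1) by (simp add: wo_rel_def)
  obtain \<zeta> where \<zeta>: "is_first \<kappa> \<zeta>"
    using Well_order_isMinim_exists[OF subset_refl assms(2)] by (auto simp: is_first_def)
  obtain T\<^sub>0 :: "('a \<Rightarrow> real) set" and h where h: "Valdivia_embedding (X \<zeta>) T\<^sub>0 h"
    using assms(5)[OF \<zeta>] by (auto simp: Valdivia_compact_def)
  define good where "good \<beta> \<gamma> c \<longleftrightarrow> (\<forall>n. continuous_map (X \<gamma>) (top_of_set {0..1}) (c n)) \<and>
    (\<forall>x\<in>topspace (X \<gamma>). \<forall>y\<in>topspace (X \<gamma>). r \<beta> \<gamma> x = r \<beta> \<gamma> y \<longrightarrow> (\<forall>n. c n x = c n y) \<longrightarrow> x = y) \<and>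
    (\<forall>y\<in>topspace (X \<beta>). \<exists>x\<in>topspace (X \<gamma>). r \<beta> \<gamma> x = y \<and> (\<forall>n. c n x = 0))"
    for \<beta> \<gamma> and c :: "nat \<Rightarrow> 'a \<Rightarrow> real"
  have next_unique: "\<beta> = \<beta>'" if "is_next \<kappa> \<beta> \<gamma>" "is_next \<kappa> \<beta>' \<gamma>" for \<beta> \<beta>' \<gamma>
  proof (rule antisymD[OF ANTISYM])
    have "(\<alpha>, \<gamma>) \<in> \<kappa>" "\<alpha> \<noteq> \<gamma>" if "is_next \<kappa> \<alpha> \<gamma>" for \<alpha>
      using that by (auto simp: is_next_def isMinim_def AboveS_def)
    then show "(\<beta>, \<beta>') \<in> \<kappa>" "(\<beta>', \<beta>) \<in> \<kappa>" using is_next_below that by blast+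
  qed
  have "\<exists>c. \<forall>\<beta>. is_next \<kappa> \<beta> \<gamma> \<longrightarrow> good \<beta> \<gamma> c" for \<gamma>
  proof (cases "\<exists>\<beta>. is_next \<kappa> \<beta> \<gamma>")
    case True
    then obtain \<beta> where \<beta>: "is_next \<kappa> \<beta> \<gamma>" by blast
    have "\<exists>c. good \<beta> \<gamma> c"
      by (rule simple_retraction_coordinates[OF assms(6)[OF \<beta>]]) (unfold good_def, blast)
    then show ?thesis using next_unique[OF \<beta>] by blast
  qed blast
  then obtain c where "\<forall>\<gamma> \<beta>. is_next \<kappa> \<beta> \<gamma> \<longrightarrow> good \<beta> \<gamma> (c \<gamma>)"
    by metis
  then have c: "good \<beta> \<gamma> (c \<gamma>)" if "is_next \<kappa> \<beta> \<gamma>" for \<beta> \<gamma>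
    using that by blast
  interpret coordinatized_sequence \<kappa> X r \<zeta> T\<^sub>0 h c
  proof
    fix \<beta> \<gamma> assume n: "is_next \<kappa> \<beta> \<gamma>"
    show "continuous_map (X \<gamma>) (top_of_set {0..1}) (c \<gamma> n)" for n
      using c[OF n] unfolding good_def by blast
    show "x = y" if "x \<in> topspace (X \<gamma>)" "y \<in> topspace (X \<gamma>)" "r \<beta> \<gamma> x = r \<beta> \<gamma> y"
      "\<And>n. c \<gamma> n x = c \<gamma> n y" for x y
      using c[OF n] that unfolding good_def by blast
    show "\<exists>x\<in>topspace (X \<gamma>). r \<beta> \<gamma> x = y \<and> (\<forall>n. c \<gamma> n x = 0)" if "y \<in> topspace (X \<beta>)" for y
      using c[OF n] that unfolding good_def by blast
    show "\<exists>G. gdelta_in (X \<beta>) G \<and> G \<noteq> {} \<and> G \<subseteq> r \<beta> \<gamma> ` U"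
      if "openin (X \<gamma>) U" "U \<noteq> {}" for U
      using assms(6)[OF n] that unfolding simple_retraction_def by blast
  qed (fact assms(3) assms(4) \<zeta> h)+
  show ?thesis by (rule Valdivia_compact_inverse_limit)
qed

end
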